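(* Let $q$ be a prime power and let $0<\rho<n\le m$ be fixed integers. For any $0<l\le n$, consider the families of integer pairs $(n_i,\rho_i)$, $0\le i\le l-1$, such that $0<n_i\le n$, $0\le\rho_i\le n_i$, and $n_i+\rho_i\le m$ for all $i$, and $\sum_{i=0}^{l-1}n_i=n$ and $\sum_{i=0}^{l-1}\rho_i=\rho$. Then $$K_R(q^m,n,\rho)\le \min_{\{(n_i,\rho_i):\,0\le i\le l-1\}}\left\{q^{m(n-\rho)-\sum_i\rho_i(n_i-\rho_i)}\right\},$$ the minimum being over all such families (that is, the bound holds for every such family).
   Context: For $\mathbf{x}\in \mathrm{GF}(q^m)^n$, $\mathrm{rk}(\mathbf{x})$ is the maximum number of coordinates of $\mathbf{x}$ that are linearly independent over $\mathrm{GF}(q)$; the rank distance is $d_R(\mathbf{x},\mathbf{y})=\mathrm{rk}(\mathbf{x}-\mathbf{y})$. The rank covering radius of a nonempty code $C\subseteq \mathrm{GF}(q^m)^n$ is $\max_{\mathbf{x}}\min_{\mathbf{c}\in C} d_R(\mathbf{x},\mathbf{c})$. $K_R(q^m,n,\rho)$ denotes the minimum number of balls of rank radius $\rho$ needed to cover $\mathrm{GF}(q^m)^n$, i.e. the minimum cardinality of a (not necessarily linear) code $C\subseteq\mathrm{GF}(q^m)^n$ with rank covering radius at most $\rho$. *)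

theory Defs
  imports
    "Jordan_Normal_Form.Matrix"
    "HOL-Library.Cardinality"
    "HOL-Number_Theory.Prime_Powers"
begin

text \<open>
  The extension \<open>GF(q) \<subseteq> GF(q^m)\<close> is an embedding of fields \<open>\<iota> :: 'k \<Rightarrow> 'a\<close>, where \<open>'k\<close> and
  \<open>'a\<close> are finite types with \<open>q\<close> and \<open>q^m\<close> elements. It makes \<open>'a\<close> a \<open>'k\<close>-vector space
  with scalar multiplication \<open>\<lambda>a v. \<iota> a * v\<close>. The space \<open>GF(q^m)^n\<close> is \<open>carrier_vec n\<close>.
\<close>

text \<open>Linear independence of the coordinates \<open>x_i\<close>, \<open>i \<in> I\<close>, as a family: equal coordinates at
  different positions are dependent, hence the injectivity condition.\<close>

definition indep_coords :: "('k::field \<Rightarrow> 'a::field) \<Rightarrow> 'a vec \<Rightarrow> nat set \<Rightarrow> bool" where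
  "indep_coords \<iota> x I \<longleftrightarrow>
     inj_on (vec_index x) I \<and> \<not> module.dependent (\<lambda>a v. \<iota> a * v) (vec_index x ` I)"

definition rk :: "('k::field \<Rightarrow> 'a::field) \<Rightarrow> 'a vec \<Rightarrow> nat" where
  "rk \<iota> x = Max {card I | I. I \<subseteq> {..<dim_vec x} \<and> indep_coords \<iota> x I}"

definition rank_dist :: "('k::field \<Rightarrow> 'a::field) \<Rightarrow> 'a vec \<Rightarrow> 'a vec \<Rightarrow> nat" where
  "rank_dist \<iota> x y = rk \<iota> (x - y)"

definition covering_radius ::
    "('k::field \<Rightarrow> 'a::{field, finite}) \<Rightarrow> nat \<Rightarrow> 'a vec set \<Rightarrow> nat" where
  "covering_radius \<iota> n C = (MAX x\<in>carrier_vec n. MIN c\<in>C. rank_dist \<iota> x c)"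

definition K_R :: "('k::field \<Rightarrow> 'a::{field, finite}) \<Rightarrow> nat \<Rightarrow> nat \<Rightarrow> nat" where
  "K_R \<iota> n \<rho> =
     Min {card C | C. C \<subseteq> carrier_vec n \<and> C \<noteq> {} \<and> covering_radius \<iota> n C \<le> \<rho>}"

end

theory Submission
  imports Defs "HOL-Algebra.Algebraic_Closure_Type" "HOL-Number_Theory.Residues"
begin

text \<open>
  A block \<open>(n, r)\<close> with \<open>n + r \<le> m\<close> has a covering code of size \<open>q^((m - r)(n - r))\<close>; juxtaposing
  the codes of the blocks gives the bound, since the rank is subadditive under concatenation.
  For a block let \<open>k = m - r \<ge> n\<close>, let \<open>a_1, \<dots>, a_n \<in> GF(q^k)\<close> be linearly independent over \<open>GF(q)\<close>,
  and write \<open>GF(q^m) = \<phi>(GF(q^k)) + Z\<close> with \<open>\<phi>\<close> linear over \<open>GF(q)\<close> and \<open>dim Z = r\<close>. The code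
  consists of the vectors \<open>(\<phi>(F(a_i)))_i\<close>, where \<open>F\<close> runs through the linearized polynomials over
  \<open>GF(q^k)\<close> of \<open>q\<close>-degree less than \<open>n - r\<close> (a Gabidulin code placed in a subspace). Given
  \<open>x_i = \<phi>(u_i) + z_i\<close>, the relations \<open>\<Sum>i. \<lambda>_i z_i = 0\<close> form a space of dimension at least
  \<open>n - r\<close>. Interpolation at \<open>n - r\<close> independent points \<open>\<Sum>i. \<lambda>_i a_i\<close> yields an \<open>F\<close> with
  \<open>\<Sum>i. \<lambda>_i F(a_i) = \<Sum>i. \<lambda>_i u_i\<close> for \<open>n - r\<close> independent relations \<open>\<lambda>\<close>. Hence \<open>x - \<phi>(F(a))\<close>
  satisfies these relations, and its rank is at most \<open>r\<close>.
\<close>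

section \<open>Counting in vector spaces over a finite field\<close>

text \<open>Forming linear combinations is a bijection from the coefficient functions on
  \<open>B\<close> onto the span. Taking these functions extensionally, in
  \<open>B \<rightarrow>\<^sub>E UNIV\<close>, makes them a finite set that can be counted.\<close>

lemma (in vector_space) card_span_independent:
  assumes "finite (UNIV :: 'a set)" "independent B" "finite B"
  shows "finite (span B)" "card (span B) = CARD('a) ^ card B"
proof -
  let ?s = "\<lambda>u. \<Sum>v\<in>B. scale (u v) v"
  have "inj_on ?s (B \<rightarrow>\<^sub>E UNIV)"
  proof (rule inj_onI)
    fix u w assume u: "u \<in> B \<rightarrow>\<^sub>E UNIV" and w: "w \<in> B \<rightarrow>\<^sub>E UNIV" and eq: "?s u = ?s w"
    have "(\<Sum>v\<in>B. scale (u v - w v) v) = 0"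
      using eq by (simp add: scale_left_diff_distrib sum_subtractf)
    hence "u v = w v" if "v \<in> B" for v
      using independentD[OF assms(2,3) subset_refl, of "\<lambda>v. u v - w v" v] that by simp
    thus "u = w" using u w by (intro PiE_ext)
  qed
  hence card_img: "card (?s ` (B \<rightarrow>\<^sub>E UNIV)) = card (B \<rightarrow>\<^sub>E (UNIV :: 'a set))"
    by (rule card_image)
  have "range ?s \<subseteq> ?s ` (B \<rightarrow>\<^sub>E UNIV)"
  proof (rule image_subsetI)
    fix u
    have "?s u = ?s (restrict u B)" by (rule sum.cong) simp_all
    moreover have "restrict u B \<in> B \<rightarrow>\<^sub>E UNIV" by simp
    ultimately show "?s u \<in> ?s ` (B \<rightarrow>\<^sub>E UNIV)" by (rule image_eqI)
  qed
  hence img: "span B = ?s ` (B \<rightarrow>\<^sub>E UNIV)"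
    unfolding span_finite[OF assms(3)] by (rule subset_antisym) (rule image_mono, rule subset_UNIV)
  have "card (span B) = card (B \<rightarrow>\<^sub>E (UNIV :: 'a set))"
    unfolding img by (rule card_img)
  thus "card (span B) = CARD('a) ^ card B" using assms by (simp add: card_PiE)
  have "finite (B \<rightarrow>\<^sub>E (UNIV :: 'a set))" using assms by (intro finite_PiE)
  thus "finite (span B)" unfolding img by (rule finite_imageI)
qed

lemma (in vector_space) finite_subspace_basis:
  assumes "finite (UNIV :: 'a set)" "subspace V" "finite V"
  obtains B where "B \<subseteq> V" "finite B" "independent B" "span B = V" "card V = CARD('a) ^ card B"
proof -
  obtain B where B: "B \<subseteq> V" "independent B" "V \<subseteq> span B"
    by (rule maximal_independent_subset)
  have "span B = V" using B assms by (intro span_subspace)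
  moreover have "finite B" using B assms finite_subset by blast
  ultimately show ?thesis using that[of B] B card_span_independent(2)[OF assms(1) B(2)] by simp
qed

text \<open>Each fibre over the image is a translate of the kernel. This is rank-nullity in counting
  form, which lets later arguments compare powers of q instead of dimensions.\<close>

lemma (in module_hom) card_image_times_card_kernel:
  assumes "m1.subspace V" "finite V"
  shows "card (f ` V) * card {v \<in> V. f v = 0} = card V"
proof -
  have "card {v \<in> V. f v = y} = card {v \<in> V. f v = 0}" if y: "y \<in> f ` V" for y
  proof -
    obtain w where w: "w \<in> V" "y = f w" using y by blast
    have "bij_betw (\<lambda>v. v - w) {v \<in> V. f v = y} {v \<in> V. f v = 0}"
      by (rule bij_betw_byWitness[where f' = "\<lambda>v. v + w"])
        (use w assms in \<open>auto simp: add diff intro: m1.subspace_add m1.subspace_diff\<close>)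
    thus ?thesis by (rule bij_betw_same_card)
  qed
  moreover have "card V = (\<Sum>y\<in>f ` V. card {v \<in> V. f v = y})"
    using sum.image_gen[OF assms(2), of "\<lambda>_. 1::nat" f] by simp
  ultimately show ?thesis by simp
qed

section \<open>Frobenius powers and the fields GF(q^k) in the algebraic closure\<close>

text \<open>Multiplication by a nonzero \<open>x\<close> permutes the nonzero elements; comparing
  the products before and after gives x^(q-1) = 1.\<close>

lemma finite_field_power_CARD:
  fixes x :: "'k::{field, finite}"
  shows "x ^ CARD('k) = x"
proof (cases "x = 0")
  case False
  let ?U = "UNIV - {0 :: 'k}"
  have "prod id ?U = prod id ((*) x ` ?U)"
  proof -
    have "(*) x ` ?U = ?U"
      using False by (intro endo_inj_surj) (auto simp: inj_on_def)
    thus ?thesis by simp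
  qed
  also have "\<dots> = x ^ card ?U * prod id ?U"
    using False by (subst prod.reindex) (auto simp: inj_on_def prod.distrib)
  finally have "x ^ card ?U = 1" by simp
  moreover have "CARD('k) = Suc (card ?U)" by (simp add: card_Suc_Diff1)
  ultimately show ?thesis by (simp only: power_Suc mult_1_right)
qed simp

lemma prime_CHAR_finite: "Factorial_Ring.prime CHAR('k::{field, finite})"
  by (intro prime_CHAR_semidom finite_imp_CHAR_pos) simp

text \<open>The characteristic is prime and divides the cardinality, so it is the prime underlying
  the prime power. The q-power map is thereby an iterate of the Frobenius map, hence
  additive.\<close>

lemma CARD_eq_CHAR_power:
  assumes "primepow CARD('k::{field, finite})"
  obtains e where "CARD('k) = CHAR('k) ^ e"
proof -
  obtain p e where pe: "Factorial_Ring.prime p" "CARD('k) = p ^ e"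
    using assms unfolding primepow_def by blast
  have "CHAR('k) dvd p ^ e"
    using CHAR_dvd_CARD[where 'a = 'k] pe by simp
  hence "CHAR('k) = p"
    using pe prime_CHAR_finite[where 'k='k] prime_dvd_power primes_dvd_imp_eq by blast
  thus ?thesis using pe that by blast
qed

lemma frobenius_add:
  fixes x y :: "'k::{field, finite} alg_closure"
  assumes "primepow CARD('k)"
  shows "(x + y) ^ (CARD('k) ^ k) = x ^ (CARD('k) ^ k) + y ^ (CARD('k) ^ k)"
proof -
  obtain e where e: "CARD('k) = CHAR('k) ^ e" using CARD_eq_CHAR_power[OF assms] .
  show ?thesis
    by (rule freshmans_dream'[where n = "e * k"])
      (use prime_CHAR_finite[where 'k='k] in \<open>simp_all add: e power_mult\<close>)
qed

lemma to_ac_frobenius: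
  fixes c :: "'k::{field, finite}"
  shows "to_ac c ^ (CARD('k) ^ k) = to_ac c"
proof (induction k)
  case (Suc k)
  have "to_ac c ^ (CARD('k) ^ Suc k) = to_ac ((c ^ CARD('k)) ^ (CARD('k) ^ k))"
    by (simp add: power_mult)
  thus ?case using Suc by (simp add: finite_field_power_CARD)
qed simp

text \<open>The algebraic closure contains GF(q^k) as a subset for every positive k. This suits the
  construction, where k = m - r varies from block to block and cannot be fixed by a type.\<close>

interpretation ac: vector_space "\<lambda>a v. to_ac a * v"
  by unfold_locales (simp_all add: distrib_left distrib_right mult.assoc)

text \<open>The subfield \<open>GF(q^k)\<close> of the algebraic closure.\<close>

definition fixed_field :: "nat \<Rightarrow> 'k::{field, finite} alg_closure set" where
  "fixed_field k = {x. x ^ (CARD('k) ^ k) = x}"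

lemma subspace_fixed_field:
  assumes "primepow CARD('k::{field, finite})"
  shows "ac.subspace (fixed_field k :: 'k alg_closure set)"
proof (rule ac.subspaceI)
  show "0 \<in> fixed_field k" by (simp add: fixed_field_def)
next
  fix x y :: "'k alg_closure" assume "x \<in> fixed_field k" "y \<in> fixed_field k"
  thus "x + y \<in> fixed_field k"
    unfolding fixed_field_def mem_Collect_eq frobenius_add[OF assms] by simp
next
  fix c and x :: "'k alg_closure" assume "x \<in> fixed_field k"
  thus "to_ac c * x \<in> fixed_field k"
    unfolding fixed_field_def mem_Collect_eq power_mult_distrib to_ac_frobenius by simp
qed

text \<open>The elements are the roots of X^Q - X with Q = q^k. This polynomial splits in the
  closure, and its derivative is the constant -1, so no root is repeated and there are exactly Q of
  them.\<close>

lemma card_fixed_field: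
  assumes "primepow CARD('k::{field, finite})" "0 < k"
  shows "finite (fixed_field k :: 'k alg_closure set)"
    and "card (fixed_field k :: 'k alg_closure set) = CARD('k) ^ k"
proof -
  let ?Q = "CARD('k) ^ k"
  define p :: "'k alg_closure poly" where "p = monom 1 ?Q - monom 1 1"
  have Q1: "1 < ?Q"
    using assms one_less_power primepow_gt_Suc_0 by (metis One_nat_def)
  have poly: "poly p x = x ^ ?Q - x" for x by (simp add: p_def poly_monom)
  have deg: "degree p = ?Q" unfolding p_def
    using Q1 by (subst diff_conv_add_uminus, subst degree_add_eq_left) (auto simp: degree_monom_eq)
  hence p0: "p \<noteq> 0" using Q1 by auto
  \<comment> \<open>The characteristic divides q, hence also Q because \<open>k\<close> is positive;
    the derivative of X^Q therefore vanishes.\<close>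
  have "of_nat CARD('k) = (0 :: 'k alg_closure)"
    unfolding of_nat_eq_0_iff_char_dvd using CHAR_dvd_CARD[where 'a = 'k] by simp
  hence "of_nat ?Q = (0 :: 'k alg_closure)" using assms(2) by simp
  hence pd: "pderiv p = - 1"
    by (simp add: p_def pderiv_diff pderiv_monom one_pCons monom_0 del: of_nat_power)
  obtain A where A: "size A = degree p" "p = smult (lead_coeff p) (\<Prod>x\<in>#A. [:-x, 1:])"
    using alg_closed_imp_factorization[OF p0] by blast
  have count_le: "count A x \<le> 1" for x
  proof (rule ccontr)
    assume "\<not> count A x \<le> 1"
    hence "{#x, x#} \<subseteq># A" by (auto simp: subseteq_mset_def)
    then obtain B where B: "A = add_mset x (add_mset x B)"
      by (metis mset_subset_eq_exists_conv add_mset_add_single union_mset_add_mset_left add_0)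
    have "p = [:-x, 1:] * ([:-x, 1:] * smult (lead_coeff p) (\<Prod>y\<in>#B. [:-y, 1:]))"
      by (subst A(2)) (simp only: B image_mset_add_mset prod_mset.add_mset mult_smult_right)
    then obtain r where "p = [:-x, 1:] * ([:-x, 1:] * r)" by blast
    hence "poly (pderiv p) x = 0" by (simp only: pderiv_mult) (simp add: pderiv_pCons)
    thus False by (simp add: pd)
  qed
  have "count A x = count (mset_set (set_mset A)) x" for x
  proof (cases "x \<in># A")
    case True
    hence "0 < count A x" by simp
    hence "count A x = 1" using count_le[of x] by linarith
    thus ?thesis using True by simp
  qed (simp add: not_in_iff)
  hence "A = mset_set (set_mset A)" by (rule multiset_eqI)
  from arg_cong[OF this, of size] have "card (set_mset A) = ?Q"
    unfolding A(1) deg size_mset_set by simp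
  moreover have "set_mset A = fixed_field k"
  proof -
    have "poly p x = lead_coeff p * (\<Prod>y\<in>#A. x - y)" for x
      using arg_cong[OF A(2), of "\<lambda>r. poly r x"]
      by (simp only: poly_smult poly_prod_mset image_mset.compositionality comp_def) simp
    hence "poly p x = 0 \<longleftrightarrow> x \<in># A" for x using p0 by (auto simp: prod_mset_zero_iff)
    thus ?thesis by (auto simp: fixed_field_def poly)
  qed
  ultimately show "card (fixed_field k :: 'k alg_closure set) = CARD('k) ^ k"
    and "finite (fixed_field k :: 'k alg_closure set)"
    using finite_set_mset[of A] by simp_all
qed

section \<open>Rank of concatenated vectors and a rank bound by kernels\<close>

lemma vector_space_field_hom:
  assumes "field_hom \<iota>"
  shows "vector_space (\<lambda>a v. \<iota> a * v)"
proof -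
  interpret field_hom \<iota> by fact
  show ?thesis
    by unfold_locales (simp_all add: distrib_left distrib_right mult.assoc hom_add hom_mult)
qed

lemma indep_coords_subset:
  assumes "field_hom \<iota>" "indep_coords \<iota> x I" "J \<subseteq> I"
  shows "indep_coords \<iota> x J"
proof -
  interpret vector_space "\<lambda>a v. \<iota> a * v" by (rule vector_space_field_hom) fact
  show ?thesis
    using assms(2) inj_on_subset[OF _ assms(3)] independent_mono[OF _ image_mono[OF assms(3)]]
    unfolding indep_coords_def by blast
qed

lemma finite_indep_cards: "finite {card I | I. I \<subseteq> {..<dim_vec x} \<and> indep_coords \<iota> x I}"
proof (rule finite_subset)
  show "{card I | I. I \<subseteq> {..<dim_vec x} \<and> indep_coords \<iota> x I} \<subseteq> card ` Pow {..<dim_vec x}"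
    by auto
qed simp

lemma card_le_rk:
  assumes "I \<subseteq> {..<dim_vec x}" "indep_coords \<iota> x I"
  shows "card I \<le> rk \<iota> x"
  unfolding rk_def by (rule Max_ge[OF finite_indep_cards]) (use assms in auto)

lemma rk_leI:
  assumes "field_hom \<iota>"
    and "\<And>I. I \<subseteq> {..<dim_vec x} \<Longrightarrow> indep_coords \<iota> x I \<Longrightarrow> card I \<le> r"
  shows "rk \<iota> x \<le> r"
proof -
  interpret vector_space "\<lambda>a v. \<iota> a * v" by (rule vector_space_field_hom) fact
  have "indep_coords \<iota> x {}" by (auto simp: indep_coords_def independent_empty)
  hence "{card I | I. I \<subseteq> {..<dim_vec x} \<and> indep_coords \<iota> x I} \<noteq> {}" by blast
  thus ?thesis unfolding rk_def using assms(2) by (intro Max.boundedI[OF finite_indep_cards]) auto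
qed

text \<open>An independent set of positions splits into those in \<open>x\<close> and those in
  \<open>y\<close>. Both parts stay independent, so each is bounded by the rank of its own
  half.\<close>

lemma rk_append_le:
  assumes "field_hom \<iota>"
  shows "rk \<iota> (x @\<^sub>v y) \<le> rk \<iota> x + rk \<iota> y"
proof (rule rk_leI[OF assms])
  fix I assume I: "I \<subseteq> {..<dim_vec (x @\<^sub>v y)}" and ind: "indep_coords \<iota> (x @\<^sub>v y) I"
  let ?n = "dim_vec x"
  let ?J = "{i \<in> I. i < ?n}" and ?K = "{j. ?n + j \<in> I}"
  have fin: "finite I" using I finite_subset by blast
  have K: "(+) ?n ` ?K = {i \<in> I. ?n \<le> i}"
    by (auto simp: image_iff) (metis le_add_diff_inverse)
  have KI: "j < dim_vec y" if "j \<in> ?K" for j using that I by auto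
  have indJ: "indep_coords \<iota> (x @\<^sub>v y) ?J" and indK: "indep_coords \<iota> (x @\<^sub>v y) ((+) ?n ` ?K)"
    using indep_coords_subset[OF assms ind] K by auto
  have eq: "vec_index (x @\<^sub>v y) i = vec_index x i" if "i \<in> ?J" for i using that I by auto
  have "inj_on (vec_index (x @\<^sub>v y)) ?J = inj_on (vec_index x) ?J"
    by (rule inj_on_cong[OF eq])
  moreover have "vec_index (x @\<^sub>v y) ` ?J = vec_index x ` ?J"
    by (rule image_cong[OF refl eq])
  ultimately have "indep_coords \<iota> x ?J"
    using indJ unfolding indep_coords_def by simp
  hence J_le: "card ?J \<le> rk \<iota> x" by (intro card_le_rk) auto
  have ext: "vec_index (x @\<^sub>v y) (?n + j) = vec_index y j" if "j \<in> ?K" for j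
    using KI[OF that] by simp
  have "inj_on (vec_index (x @\<^sub>v y) \<circ> (+) ?n) ?K"
    using indK unfolding indep_coords_def by (intro comp_inj_on) auto
  hence "inj_on (vec_index y) ?K"
    using ext by (subst inj_on_cong[where g = "vec_index (x @\<^sub>v y) \<circ> (+) ?n"]) auto
  moreover have "vec_index y ` ?K = vec_index (x @\<^sub>v y) ` (+) ?n ` ?K"
    unfolding image_image using ext by (intro image_cong) auto
  ultimately have "indep_coords \<iota> y ?K"
    using indK unfolding indep_coords_def by simp
  hence "card ?K \<le> rk \<iota> y" using KI by (intro card_le_rk) auto
  moreover have "card ((+) ?n ` ?K) = card ?K" by (intro card_image) auto
  moreover have "card I = card ?J + card ((+) ?n ` ?K)"
    unfolding K using fin by (subst card_Un_disjoint[symmetric]) (auto intro: arg_cong[of _ _ card])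
  ultimately show "card I \<le> rk \<iota> x + rk \<iota> y" using J_le by linarith
qed

lemma rk_le_of_kernel:
  fixes \<iota> :: "'k::{field, finite} \<Rightarrow> 'a::field"
  assumes "field_hom \<iota>" and lin: "Vector_Spaces.linear s (\<lambda>a v. \<iota> a * v) f"
    and V: "module.subspace s V" "finite V"
    and ker: "card V \<le> card {v \<in> V. f v = 0} * CARD('k) ^ r"
    and y: "\<And>i. i < dim_vec y \<Longrightarrow> vec_index y i \<in> f ` V"
  shows "rk \<iota> y \<le> r"
proof (rule rk_leI[OF assms(1)])
  interpret f: Vector_Spaces.linear s "\<lambda>a v. \<iota> a * v" f by (rule lin)
  have q: "1 < CARD('k)"
    using card_mono[of UNIV "{0, 1 :: 'k}"] by simp
  fix I assume I: "I \<subseteq> {..<dim_vec y}" and "indep_coords \<iota> y I"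
  hence inj: "inj_on (vec_index y) I" and ind: "\<not> f.vs2.dependent (vec_index y ` I)"
    by (auto simp: indep_coords_def)
  have finI: "finite I" using I finite_subset by blast
  have "f.vs2.span (vec_index y ` I) \<subseteq> f ` V"
    using I y by (intro f.vs2.span_minimal f.subspace_image V) auto
  hence "CARD('k) ^ card I \<le> card (f ` V)"
    using f.vs2.card_span_independent[OF _ ind] finI V card_image[OF inj]
    by (metis card_mono finite finite_imageI)
  moreover have "card (f ` V) \<le> CARD('k) ^ r"
  proof -
    have "0 \<in> {v \<in> V. f v = 0}" using f.vs1.subspace_0[OF V(1)] f.zero by simp
    hence "0 < card {v \<in> V. f v = 0}" using V(2) by (subst card_gt_0_iff) auto
    moreover have "card (f ` V) * card {v \<in> V. f v = 0} \<le> CARD('k) ^ r * card {v \<in> V. f v = 0}"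
      using ker f.card_image_times_card_kernel[OF V] by (simp add: mult.commute)
    ultimately show ?thesis by simp
  qed
  ultimately have "CARD('k) ^ card I \<le> CARD('k) ^ r" by linarith
  thus "card I \<le> r" by (rule power_le_imp_le_exp[OF q])
qed

section \<open>Linearized polynomials and interpolation\<close>

definition linearized :: "nat \<Rightarrow> (nat \<Rightarrow> 'k::{field, finite} alg_closure) \<Rightarrow> 'k alg_closure \<Rightarrow> 'k alg_closure"
  where "linearized d c x = (\<Sum>j<d. c j * x ^ (CARD('k) ^ j))"

lemma linear_linearized:
  assumes "primepow CARD('k::{field, finite})"
  shows "Vector_Spaces.linear (\<lambda>a v. to_ac a * v) (\<lambda>a v. to_ac a * v) (linearized d c :: 'k alg_closure \<Rightarrow> _)"
proof (unfold Vector_Spaces.linear_iff, intro conjI allI)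
  fix x y :: "'k alg_closure"
  show "linearized d c (x + y) = linearized d c x + linearized d c y"
    by (simp only: linearized_def frobenius_add[OF assms] distrib_left sum.distrib)
next
  fix a :: 'k and x
  show "linearized d c (to_ac a * x) = to_ac a * linearized d c x"
    unfolding linearized_def power_mult_distrib to_ac_frobenius sum_distrib_left
    by (simp only: mult.left_commute)
qed (rule ac.vector_space_axioms)+

text \<open>The q^j-power and q^k-power maps commute, so powers of fixed elements are again fixed;
  products and sums stay in the field.\<close>

lemma linearized_in_fixed_field:
  fixes x :: "'k::{field, finite} alg_closure"
  assumes "primepow CARD('k)" "\<And>j. j < d \<Longrightarrow> c j \<in> fixed_field k" "x \<in> fixed_field k"
  shows "linearized d c x \<in> fixed_field k"
  unfolding linearized_def
proof (rule ac.subspace_sum[OF subspace_fixed_field[OF assms(1)]])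
  fix j assume "j \<in> {..<d}"
  hence c: "c j ^ (CARD('k) ^ k) = c j" using assms(2) by (simp add: fixed_field_def)
  have x: "x ^ (CARD('k) ^ k) = x" using assms(3) by (simp add: fixed_field_def)
  have "(x ^ (CARD('k) ^ j)) ^ (CARD('k) ^ k) = (x ^ (CARD('k) ^ k)) ^ (CARD('k) ^ j)"
    by (simp only: power_mult[symmetric] mult.commute)
  thus "c j * x ^ (CARD('k) ^ j) \<in> fixed_field k"
    unfolding fixed_field_def mem_Collect_eq power_mult_distrib c x by simp
qed

text \<open>By linearity the polynomial vanishes on the whole span of \<open>P\<close>, which has
  q^d elements, while its degree is at most q^(d-1). It is therefore the zero polynomial.\<close>

lemma linearized_eq_0_imp:
  fixes P :: "'k::{field, finite} alg_closure set"
  assumes "primepow CARD('k)" "finite P" "ac.independent P" "card P = d"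
    and zero: "\<And>x. x \<in> P \<Longrightarrow> linearized d c x = 0" and "j < d"
  shows "c j = 0"
proof -
  let ?q = "CARD('k)"
  have q: "1 < ?q" using assms(1) primepow_gt_Suc_0 by simp
  interpret l: Vector_Spaces.linear "\<lambda>a v. to_ac a * v" "\<lambda>a v. to_ac a * v" "linearized d c :: 'k alg_closure \<Rightarrow> _"
    by (rule linear_linearized[OF assms(1)])
  define p where "p = (\<Sum>i<d. monom (c i) (?q ^ i))"
  have poly: "poly p x = linearized d c x" for x
    by (simp add: p_def linearized_def poly_sum poly_monom)
  have "degree p \<le> ?q ^ (d - 1)" unfolding p_def
  proof (rule degree_sum_le)
    fix i assume "i \<in> {..<d}"
    hence "?q ^ i \<le> ?q ^ (d - 1)" using q by (intro power_increasing) auto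
    thus "degree (monom (c i) (?q ^ i)) \<le> ?q ^ (d - 1)"
      using degree_monom_le order_trans by blast
  qed simp
  also have "\<dots> < ?q ^ d" using q assms(6) by (intro power_strict_increasing) auto
  also have "\<dots> = card (ac.span P)"
    using ac.card_span_independent(2)[OF _ assms(3,2)] assms(4) by simp
  finally have deg: "degree p < card (ac.span P)" .
  have sub: "ac.span P \<subseteq> {x. poly p x = 0}"
    using l.eq_0_on_span[OF zero] by (auto simp: poly)
  have "p = 0"
  proof (rule ccontr)
    assume "p \<noteq> 0"
    hence "card (ac.span P) \<le> degree p"
      using card_mono[OF poly_roots_finite sub] card_poly_roots_bound le_trans by blast
    thus False using deg by simp
  qed
  hence "0 = coeff p (?q ^ j)" by simp
  also have "\<dots> = (\<Sum>i<d. coeff (monom (c i) (?q ^ i)) (?q ^ j))"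
    by (simp only: p_def coeff_sum)
  \<comment> \<open>The exponents q^i are pairwise distinct since q > 1, so only the summand i = j
    contributes.\<close>
  also have "\<dots> = (\<Sum>i<d. if i = j then c i else 0)"
    using q by (intro sum.cong) auto
  also have "\<dots> = c j" using assms(6) by simp
  finally show ?thesis by simp
qed

text \<open>Evaluation at \<open>P\<close> maps coefficient tuples over GF(q^k) to value tuples over
  GF(q^k). It is injective by \<open>linearized_eq_0_imp\<close>, and both sides have the same
  finite cardinality because \<open>card P = d\<close>, so it is onto.\<close>

lemma linearized_interpolation:
  fixes P :: "'k::{field, finite} alg_closure set"
  assumes "primepow CARD('k)" "0 < k" "finite P" "ac.independent P" "card P = d"
    and PL: "P \<subseteq> fixed_field k" and g: "\<And>x. x \<in> P \<Longrightarrow> g x \<in> fixed_field k"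
  shows "\<exists>c\<in>{..<d} \<rightarrow>\<^sub>E fixed_field k. \<forall>x\<in>P. linearized d c x = g x"
proof -
  let ?L = "fixed_field k :: 'k alg_closure set"
  let ?ev = "\<lambda>c. restrict (linearized d c) P"
  have inj: "inj_on ?ev ({..<d} \<rightarrow>\<^sub>E ?L)"
  proof (rule inj_onI)
    fix b c assume b: "b \<in> {..<d} \<rightarrow>\<^sub>E ?L" and c: "c \<in> {..<d} \<rightarrow>\<^sub>E ?L" and eq: "?ev b = ?ev c"
    have "linearized d (\<lambda>j. b j - c j) x = 0" if "x \<in> P" for x
    proof -
      have "linearized d b x = linearized d c x"
        using fun_cong[OF eq, of x] that by simp
      thus ?thesis by (simp add: linearized_def left_diff_distrib sum_subtractf)
    qed
    hence "b j - c j = 0" if "j < d" for j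
      by (rule linearized_eq_0_imp[OF assms(1,3,4,5) _ that])
    thus "b = c" using b c by (intro PiE_ext) auto
  qed
  have "?ev ` ({..<d} \<rightarrow>\<^sub>E ?L) = P \<rightarrow>\<^sub>E ?L"
  proof (rule card_subset_eq)
    show "finite (P \<rightarrow>\<^sub>E ?L)" using assms(3) card_fixed_field(1)[OF assms(1,2)] by (intro finite_PiE)
    show "?ev ` ({..<d} \<rightarrow>\<^sub>E ?L) \<subseteq> P \<rightarrow>\<^sub>E ?L"
      using PL by (auto intro!: linearized_in_fixed_field[OF assms(1)])
    show "card (?ev ` ({..<d} \<rightarrow>\<^sub>E ?L)) = card (P \<rightarrow>\<^sub>E ?L)"
      unfolding card_image[OF inj] using assms(3,5) by (simp add: card_PiE)
  qed
  moreover have "restrict g P \<in> P \<rightarrow>\<^sub>E ?L" using g by auto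
  ultimately have "restrict g P \<in> ?ev ` ({..<d} \<rightarrow>\<^sub>E ?L)" by (simp only:)
  then obtain c where c: "c \<in> {..<d} \<rightarrow>\<^sub>E ?L" "restrict g P = ?ev c" by (rule imageE)
  have "linearized d c x = g x" if "x \<in> P" for x
    using fun_cong[OF c(2), of x] that by simp
  thus ?thesis using c(1) by blast
qed

section \<open>Covering codes and their juxtaposition\<close>

text \<open>Stating the covering property pointwise, without \<open>Max\<close> and
  \<open>Min\<close>, makes it easy to combine codes; \<open>K_R_le_card\<close> translates
  back.\<close>

definition rank_covering ::
    "('k::field \<Rightarrow> 'a::field) \<Rightarrow> nat \<Rightarrow> nat \<Rightarrow> 'a vec set \<Rightarrow> bool" where
  "rank_covering \<iota> n r C \<longleftrightarrow> C \<subseteq> carrier_vec n \<and> (\<forall>x\<in>carrier_vec n. \<exists>c\<in>C. rk \<iota> (x - c) \<le> r)"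

lemma finite_carrier_vec: "finite (carrier_vec n :: 'a::finite vec set)"
proof (rule finite_subset)
  show "carrier_vec n \<subseteq> vec n ` ({..<n} \<rightarrow>\<^sub>E (UNIV :: 'a set))"
  proof
    fix x :: "'a vec" assume "x \<in> carrier_vec n"
    show "x \<in> vec n ` ({..<n} \<rightarrow>\<^sub>E (UNIV :: 'a set))"
    proof (rule image_eqI)
      show "x = vec n (restrict (vec_index x) {..<n})"
        using \<open>x \<in> carrier_vec n\<close> by (intro eq_vecI) auto
    qed simp
  qed
  show "finite (vec n ` ({..<n} \<rightarrow>\<^sub>E (UNIV :: 'a set)))"
    by (intro finite_imageI finite_PiE) auto
qed

lemma K_R_le_card:
  fixes \<iota> :: "'k::field \<Rightarrow> 'a::{field, finite}"
  assumes "rank_covering \<iota> n r C"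
  shows "K_R \<iota> n r \<le> card C"
proof -
  have C: "C \<subseteq> carrier_vec n" and cov: "\<And>x. x \<in> carrier_vec n \<Longrightarrow> \<exists>c\<in>C. rk \<iota> (x - c) \<le> r"
    using assms by (auto simp: rank_covering_def)
  have finC: "finite C" using C finite_carrier_vec finite_subset by blast
  have ne: "C \<noteq> {}" using cov[of "0\<^sub>v n"] by auto
  have "covering_radius \<iota> n C \<le> r"
    unfolding covering_radius_def
  proof (rule Max.boundedI)
    show "finite ((\<lambda>x. MIN c\<in>C. rank_dist \<iota> x c) ` carrier_vec n)"
      by (intro finite_imageI finite_carrier_vec)
    have "(0\<^sub>v n :: 'a vec) \<in> carrier_vec n" by simp
    thus "(\<lambda>x. MIN c\<in>C. rank_dist \<iota> x c) ` carrier_vec n \<noteq> {}" by blast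
    fix y assume "y \<in> (\<lambda>x. MIN c\<in>C. rank_dist \<iota> x c) ` carrier_vec n"
    then obtain x where x: "x \<in> carrier_vec n" and y: "y = (MIN c\<in>C. rank_dist \<iota> x c)" by blast
    obtain c where "c \<in> C" "rk \<iota> (x - c) \<le> r" using cov[OF x] by blast
    thus "y \<le> r" unfolding y rank_dist_def using finC ne by (subst Min_le_iff) auto
  qed
  moreover have "finite {card C | C. C \<subseteq> carrier_vec n \<and> C \<noteq> {} \<and> covering_radius \<iota> n C \<le> r}"
    by (rule finite_subset[of _ "card ` Pow (carrier_vec n :: 'a vec set)"])
      (auto simp: finite_carrier_vec)
  ultimately show ?thesis
    unfolding K_R_def using C ne by (intro Min_le) auto
qed

text \<open>Each half of a vector is approximated separately, and the two errors add up by
  \<open>rk_append_le\<close>.\<close>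

lemma rank_covering_append:
  fixes \<iota> :: "'k::field \<Rightarrow> 'a::field"
  assumes "field_hom \<iota>" "rank_covering \<iota> n1 r1 C1" "rank_covering \<iota> n2 r2 C2"
  shows "rank_covering \<iota> (n1 + n2) (r1 + r2) ((\<lambda>(c, d). c @\<^sub>v d) ` (C1 \<times> C2))"
  unfolding rank_covering_def
proof (intro conjI ballI)
  have C1: "C1 \<subseteq> carrier_vec n1" and C2: "C2 \<subseteq> carrier_vec n2"
    using assms(2,3) by (auto simp: rank_covering_def)
  show "(\<lambda>(c, d). c @\<^sub>v d) ` (C1 \<times> C2) \<subseteq> carrier_vec (n1 + n2)"
    using C1 C2 by auto
  fix x :: "'a vec" assume x: "x \<in> carrier_vec (n1 + n2)"
  let ?u = "vec_first x n1" and ?v = "vec_last x n2"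
  have u: "?u \<in> carrier_vec n1" and v: "?v \<in> carrier_vec n2" by simp_all
  obtain c d where c: "c \<in> C1" "rk \<iota> (?u - c) \<le> r1" and d: "d \<in> C2" "rk \<iota> (?v - d) \<le> r2"
    using assms(2,3) u v unfolding rank_covering_def by blast
  have "x = ?u @\<^sub>v ?v" using vec_first_last_append[OF x] by simp
  moreover have "(?u @\<^sub>v ?v) - (c @\<^sub>v d) = (?u - c) @\<^sub>v (?v - d)"
  proof (intro eq_vecI)
    have dims: "dim_vec ?u = n1" "dim_vec ?v = n2" "dim_vec c = n1" "dim_vec d = n2"
      using u v c(1) d(1) C1 C2 by auto
    show "vec_index ((?u @\<^sub>v ?v) - (c @\<^sub>v d)) i = vec_index ((?u - c) @\<^sub>v (?v - d)) i"
      if "i < dim_vec ((?u - c) @\<^sub>v (?v - d))" for i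
      using that dims by simp
  qed (use u v c(1) d(1) C1 C2 in auto)
  ultimately have "rk \<iota> (x - (c @\<^sub>v d)) \<le> r1 + r2"
    using rk_append_le[OF assms(1), of "?u - c" "?v - d"] c(2) d(2) by simp
  thus "\<exists>c\<in>(\<lambda>(c, d). c @\<^sub>v d) ` (C1 \<times> C2). rk \<iota> (x - c) \<le> r1 + r2"
    using c(1) d(1) by force
qed

lemma rank_covering_sum:
  fixes \<iota> :: "'k::field \<Rightarrow> 'a::{field, finite}" and l :: nat
  assumes "field_hom \<iota>"
    and "\<And>i. i < l \<Longrightarrow> \<exists>C. rank_covering \<iota> (N i) (R i) C \<and> card C \<le> q ^ e i"
  shows "\<exists>C. rank_covering \<iota> (\<Sum>i<l. N i) (\<Sum>i<l. R i) C \<and> card C \<le> q ^ (\<Sum>i<l. e i)"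
  using assms(2)
proof (induction l)
  case 0
  have rk0: "rk \<iota> (x :: 'a vec) = 0" if "dim_vec x = 0" for x
    using rk_leI[OF assms(1), of x 0] that by simp
  \<comment> \<open>The empty family is covered by the single word of length 0, which matches the
    empty product of sizes.\<close>
  hence "rank_covering \<iota> 0 0 {vNil}"
    by (auto simp: rank_covering_def intro!: rk0)
  thus ?case by (intro exI[of _ "{vNil}"]) simp
next
  case (Suc l)
  obtain C where C: "rank_covering \<iota> (\<Sum>i<l. N i) (\<Sum>i<l. R i) C" "card C \<le> q ^ (\<Sum>i<l. e i)"
    using Suc by auto
  obtain D where D: "rank_covering \<iota> (N l) (R l) D" "card D \<le> q ^ e l"
    using Suc.prems[of l] by auto
  have "finite C" "finite D"
    using C(1) D(1) unfolding rank_covering_def by (auto intro: finite_subset[OF _ finite_carrier_vec])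
  hence "card ((\<lambda>(c, d). c @\<^sub>v d) ` (C \<times> D)) \<le> card C * card D"
    by (metis card_cartesian_product card_image_le finite_cartesian_product)
  also have "\<dots> \<le> q ^ (\<Sum>i<Suc l. e i)"
    using mult_le_mono[OF C(2) D(2)] by (simp add: power_add)
  finally show ?case
    using rank_covering_append[OF assms(1) C(1) D(1)] by auto
qed

section \<open>The covering code of a single block\<close>

text \<open>The condition \<open>n + r \<le> m\<close> gives n \<le> k for k = m - r, which leaves
  room for n independent evaluation points in GF(q^k).\<close>

lemma rank_covering_block:
  fixes \<iota> :: "'k::{field, finite} \<Rightarrow> 'a::{field, finite}"
  assumes "field_hom \<iota>" and pp: "primepow CARD('k)" and card_a: "CARD('a) = CARD('k) ^ m"
    and "0 < n" "r \<le> n" "n + r \<le> m"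
  shows "\<exists>C. rank_covering \<iota> n r C \<and> card C \<le> CARD('k) ^ ((m - r) * (n - r))"
proof -
  interpret V: vector_space "\<lambda>a v. \<iota> a * v" by (rule vector_space_field_hom) fact
  interpret VP: vector_space_pair "\<lambda>a v. to_ac a * v" "\<lambda>a v. \<iota> a * v" ..
  interpret AP: vector_space_pair "\<lambda>a v. to_ac a * v" "\<lambda>a v. to_ac a * v" ..
  let ?q = "CARD('k)"
  have q: "1 < ?q" using pp primepow_gt_Suc_0 by simp
  define k where "k = m - r"
  have k: "0 < k" "n \<le> k" "k + r = m" using assms(4-6) by (auto simp: k_def)
  define L :: "'k alg_closure set" where "L = fixed_field k"
  have L: "ac.subspace L" "finite L" "card L = ?q ^ k"
    unfolding L_def using subspace_fixed_field[OF pp] card_fixed_field[OF pp k(1)] by auto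
  obtain BL where BL: "BL \<subseteq> L" "finite BL" "ac.independent BL" "ac.span BL = L"
    "card L = ?q ^ card BL"
    by (rule ac.finite_subspace_basis[OF _ L(1,2)]) simp
  have card_BL: "card BL = k" using BL(5) L(3) q by simp
  obtain BA where BA: "finite BA" "V.independent BA" "V.span BA = UNIV"
    "CARD('a) = ?q ^ card BA"
    by (rule V.finite_subspace_basis[OF _ V.subspace_UNIV]) simp_all
  have card_BA: "card BA = m" using BA(4) card_a q by simp
  \<comment> \<open>A basis of GF(q^m) is split: \<open>B1\<close> becomes the image under \<phi> of
    a basis of GF(q^k), and the remaining r vectors span \<open>Z\<close>.\<close>
  obtain B1 where B1: "B1 \<subseteq> BA" "card B1 = k" using obtain_subset_with_card_n[of k BA] card_BA k by auto
  define Z where "Z = V.span (BA - B1)"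
  have finB1: "finite B1" using B1 BA(1) finite_subset by blast
  have "card (BA - B1) = r" using B1 card_BA k finB1 by (simp add: card_Diff_subset)
  hence card_Z: "card Z = ?q ^ r"
    using V.card_span_independent(2)[OF _ V.independent_mono[OF BA(2), of "BA - B1"]] BA(1)
    by (simp add: Z_def)
  obtain h where h: "bij_betw h BL B1"
    using finite_same_card_bij[OF BL(2) finB1] card_BL B1(2) by auto
  obtain \<phi> where \<phi>: "Vector_Spaces.linear (\<lambda>a v. to_ac a * v) (\<lambda>a v. \<iota> a * v) \<phi>"
    and \<phi>h: "\<forall>b\<in>BL. \<phi> b = h b"
    using VP.linear_independent_extend[OF BL(3), of h] by blast
  interpret \<phi>: Vector_Spaces.linear "\<lambda>a v. to_ac a * v" "\<lambda>a v. \<iota> a * v" \<phi> by (rule \<phi>)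
  have "\<phi> ` BL = B1" using \<phi>h h by (simp add: bij_betw_def)
  hence \<phi>L: "\<phi> ` L = V.span B1" using \<phi>.span_image[of BL] BL(4) by simp
  have "\<exists>u z. u \<in> L \<and> z \<in> Z \<and> x = \<phi> u + z" for x
  proof -
    have "B1 \<union> (BA - B1) = BA" using B1(1) by blast
    hence "x \<in> V.span (B1 \<union> (BA - B1))" using BA(3) by simp
    then obtain y z where "y \<in> V.span B1" "z \<in> Z" "x = y + z"
      unfolding V.span_Un Z_def by blast
    thus ?thesis using \<phi>L by (metis imageE)
  qed
  \<comment> \<open>These are bare choices of a decomposition; linearity enters only through the
    extensions \<open>G\<close> and \<open>T\<close> below.\<close>
  then obtain u z where uz: "\<And>x. u x \<in> L" "\<And>x. z x \<in> Z" "\<And>x. x = \<phi> (u x) + z x"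
    by metis
  obtain A where A: "A \<subseteq> BL" "card A = n" using obtain_subset_with_card_n[of n BL] card_BL k by auto
  have finA: "finite A" and indA: "ac.independent A"
    using A(1) BL(2,3) finite_subset ac.independent_mono by blast+
  obtain a where a: "bij_betw a {..<n} A"
    using finite_same_card_bij[of "{..<n}" A] finA A(2) by auto
  define b where "b = inv_into {..<n} a"
  have ba: "b (a i) = i" if "i < n" for i
    unfolding b_def using a that by (intro inv_into_f_f) (auto simp: bij_betw_def)
  have aA: "a i \<in> A" if "i < n" for i using a that by (auto simp: bij_betw_def)
  \<comment> \<open>The elements of \<open>S\<close> encode the possible relations: a tuple
    \<lambda> over GF(q) corresponds to \<Sum>i. \<lambda>_i a_i.\<close>
  define S where "S = ac.span A"
  have S: "ac.subspace S" "finite S" "card S = ?q ^ n"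
    unfolding S_def using ac.card_span_independent[OF _ indA finA] A(2) by auto
  have SL: "S \<subseteq> L" unfolding S_def using A(1) BL(4) ac.span_mono by blast
  define code where "code c = vec n (\<lambda>i. \<phi> (linearized (n - r) c (a i)))" for c
  define C where "C = code ` ({..<n - r} \<rightarrow>\<^sub>E L)"
  have "rank_covering \<iota> n r C"
    unfolding rank_covering_def
  proof (intro conjI ballI)
    show "C \<subseteq> carrier_vec n" unfolding C_def code_def by (rule image_subsetI) simp
    fix x :: "'a vec" assume x: "x \<in> carrier_vec n"
    \<comment> \<open>\<open>G\<close> and \<open>T\<close> send \<Sum>i. \<lambda>_i a_i to
      \<Sum>i. \<lambda>_i u_i and \<Sum>i. \<lambda>_i z_i, where u_i and z_i are the parts of the
      i-th coordinate of \<open>x\<close>.\<close>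
    obtain G where G: "Vector_Spaces.linear (\<lambda>a v. to_ac a * v) (\<lambda>a v. to_ac a * v) G"
      and GA: "\<forall>v\<in>A. G v = u (vec_index x (b v))"
      using AP.linear_independent_extend[OF indA, of "\<lambda>v. u (vec_index x (b v))"] by blast
    obtain T where T: "Vector_Spaces.linear (\<lambda>a v. to_ac a * v) (\<lambda>a v. \<iota> a * v) T"
      and TA: "\<forall>v\<in>A. T v = z (vec_index x (b v))"
      using VP.linear_independent_extend[OF indA, of "\<lambda>v. z (vec_index x (b v))"] by blast
    interpret G: Vector_Spaces.linear "\<lambda>a v. to_ac a * v" "\<lambda>a v. to_ac a * v" G by (rule G)
    interpret T: Vector_Spaces.linear "\<lambda>a v. to_ac a * v" "\<lambda>a v. \<iota> a * v" T by (rule T)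
    have GS: "G ` S \<subseteq> L"
      unfolding S_def G.span_image[symmetric]
      by (rule ac.span_minimal[OF _ L(1)]) (use GA uz(1) in auto)
    have TS: "T ` S \<subseteq> Z"
      unfolding S_def T.span_image[symmetric]
      unfolding Z_def by (rule V.span_minimal[OF _ V.subspace_span]) (use TA uz(2) Z_def in auto)
    \<comment> \<open>\<open>W\<close> encodes the relations among the z_i. Since \<open>T\<close>
      maps \<open>S\<close> into \<open>Z\<close>, which has q^r elements, \<open>W\<close> has at
      least q^(n-r) elements.\<close>
    define W where "W = {v \<in> S. T v = 0}"
    have W: "ac.subspace W" "finite W"
    proof -
      have "W = S \<inter> {v. T v = 0}" by (auto simp: W_def)
      thus "ac.subspace W" using ac.subspace_inter[OF S(1) T.subspace_kernel] by simp
      show "finite W" using S(2) by (simp add: W_def)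
    qed
    have "card (T ` S) \<le> ?q ^ r" using card_mono[OF _ TS] card_Z by simp
    hence "?q ^ n \<le> ?q ^ r * card W"
      using T.card_image_times_card_kernel[OF S(1,2)] S(3)
      unfolding W_def by (metis mult_le_mono1)
    moreover have "?q ^ n = ?q ^ r * ?q ^ (n - r)"
      using assms(5) by (simp add: power_add[symmetric])
    ultimately have "?q ^ (n - r) \<le> card W" using q by simp
    moreover obtain BW where BW: "BW \<subseteq> W" "finite BW" "ac.independent BW" "card W = ?q ^ card BW"
      by (rule ac.finite_subspace_basis[OF _ W]) simp_all
    ultimately have "n - r \<le> card BW" using q by (metis power_le_imp_le_exp)
    then obtain P where P: "P \<subseteq> BW" "card P = n - r" "finite P"
      using obtain_subset_with_card_n by blast
    have indP: "ac.independent P" using ac.independent_mono[OF BW(3) P(1)] .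
    have PS: "P \<subseteq> S" using P(1) BW(1) by (auto simp: W_def)
    have PF: "P \<subseteq> fixed_field k" using PS SL unfolding L_def by (rule subset_trans)
    have GF: "G v \<in> fixed_field k" if "v \<in> P" for v using that PS GS L_def by blast
    obtain c where c: "c \<in> {..<n - r} \<rightarrow>\<^sub>E fixed_field k"
      and cG: "\<forall>v\<in>P. linearized (n - r) c v = G v"
      using linearized_interpolation[OF pp k(1) P(3) indP P(2) PF, where g = G, OF GF] by blast
    let ?F = "linearized (n - r) c"
    have F: "Vector_Spaces.linear (\<lambda>a v. to_ac a * v) (\<lambda>a v. to_ac a * v) ?F"
      by (rule linear_linearized[OF pp])
    interpret F: Vector_Spaces.linear "\<lambda>a v. to_ac a * v" "\<lambda>a v. to_ac a * v" ?F by (rule F)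
    \<comment> \<open>\<open>Y\<close> takes a_i to the i-th coordinate of
      \<open>x - code c\<close>, so the rank of this difference is controlled by the kernel of
      \<open>Y\<close> on \<open>S\<close>.\<close>
    define Y where "Y v = \<phi> (G v) + T v - \<phi> (?F v)" for v
    have Y: "Vector_Spaces.linear (\<lambda>a v. to_ac a * v) (\<lambda>a v. \<iota> a * v) Y"
      unfolding Vector_Spaces.linear_iff Y_def
    proof (intro conjI allI)
      fix v w
      show "\<phi> (G (v + w)) + T (v + w) - \<phi> (?F (v + w)) =
        \<phi> (G v) + T v - \<phi> (?F v) + (\<phi> (G w) + T w - \<phi> (?F w))"
        by (simp only: G.add T.add F.add \<phi>.add) simp
    next
      fix a v
      show "\<phi> (G (to_ac a * v)) + T (to_ac a * v) - \<phi> (?F (to_ac a * v)) =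
        \<iota> a * (\<phi> (G v) + T v - \<phi> (?F v))"
        by (simp only: G.scale T.scale F.scale \<phi>.scale distrib_left right_diff_distrib)
    qed (rule ac.vector_space_axioms V.vector_space_axioms)+
    interpret Y: Vector_Spaces.linear "\<lambda>a v. to_ac a * v" "\<lambda>a v. \<iota> a * v" Y by (rule Y)
    \<comment> \<open>On \<open>P\<close> the map \<open>T\<close> vanishes, and the interpolation
      makes \<open>?F\<close> agree with \<open>G\<close>.\<close>
    have "Y v = 0" if "v \<in> P" for v
    proof -
      have "T v = 0" using that P(1) BW(1) by (auto simp: W_def)
      thus ?thesis using bspec[OF cG that] by (simp add: Y_def)
    qed
    hence "ac.span P \<subseteq> {v \<in> S. Y v = 0}"
      using Y.eq_0_on_span ac.span_minimal[OF PS S(1)] by blast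
    moreover have "card (ac.span P) = ?q ^ (n - r)"
      using ac.card_span_independent(2)[OF _ indP P(3)] P(2) by simp
    ultimately have "?q ^ (n - r) \<le> card {v \<in> S. Y v = 0}"
      using card_mono[of "{v \<in> S. Y v = 0}" "ac.span P"] S(2) by simp
    \<comment> \<open>A kernel of size at least q^(n-r) inside \<open>S\<close>, of size q^n, has
      codimension at most r, as \<open>rk_le_of_kernel\<close> requires.\<close>
    hence "?q ^ (n - r) * ?q ^ r \<le> card {v \<in> S. Y v = 0} * ?q ^ r"
      by (rule mult_le_mono1)
    hence ker: "card S \<le> card {v \<in> S. Y v = 0} * ?q ^ r"
      unfolding S(3) using assms(5) by (simp flip: power_add)
    have "rk \<iota> (x - code c) \<le> r"
    proof (rule rk_le_of_kernel[OF assms(1) Y S(1,2) ker])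
      fix i assume "i < dim_vec (x - code c)"
      hence i: "i < n" by (simp add: code_def)
      have "vec_index (x - code c) i = vec_index x i - \<phi> (?F (a i))"
        using i x by (simp add: code_def)
      also have "\<dots> = Y (a i)"
        using GA TA aA[OF i] ba[OF i] uz(3)[of "vec_index x i"] by (simp add: Y_def)
      finally show "vec_index (x - code c) i \<in> Y ` S"
        using aA[OF i] ac.span_base by (auto simp: S_def)
    qed
    thus "\<exists>c\<in>C. rk \<iota> (x - c) \<le> r" using c unfolding C_def L_def by blast
  qed
  moreover have "card C \<le> ?q ^ (k * (n - r))"
  proof -
    have "card C \<le> card ({..<n - r} \<rightarrow>\<^sub>E L)"
      unfolding C_def using L(2) by (intro card_image_le finite_PiE) auto
    thus ?thesis by (simp add: card_PiE L(3) power_mult)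
  qed
  ultimately show ?thesis unfolding k_def by blast
qed

section \<open>Combining the blocks of a family\<close>

theorem proposition10:
  fixes \<iota> :: "'k::{field, finite} \<Rightarrow> 'a::{field, finite}"
    and q m n \<rho> l :: nat
    and N R :: "nat \<Rightarrow> nat"
  assumes "primepow q"
    and "field_hom \<iota>"
    and "CARD('k) = q"
    and "CARD('a) = q ^ m"
    and "0 < \<rho>" and "\<rho> < n" and "n \<le> m"
    and "0 < l" and "l \<le> n"
    and "\<And>i. i < l \<Longrightarrow> 0 < N i \<and> N i \<le> n"
    and "\<And>i. i < l \<Longrightarrow> R i \<le> N i"
    and "\<And>i. i < l \<Longrightarrow> N i + R i \<le> m"
    and "(\<Sum>i<l. N i) = n"
    and "(\<Sum>i<l. R i) = \<rho>"
  shows "K_R \<iota> n \<rho> \<le> q ^ (m * (n - \<rho>) - (\<Sum>i<l. R i * (N i - R i)))"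
proof -
  have "\<exists>C. rank_covering \<iota> (N i) (R i) C \<and> card C \<le> q ^ ((m - R i) * (N i - R i))" if "i < l" for i
    unfolding assms(3)[symmetric]
  proof (rule rank_covering_block[OF assms(2)])
    show "primepow CARD('k)" "CARD('a) = CARD('k) ^ m" using assms(1,3,4) by simp_all
    show "0 < N i" "R i \<le> N i" "N i + R i \<le> m" using assms(10-12)[OF that] by simp_all
  qed
  from rank_covering_sum[where l = l and N = N and R = R and e = "\<lambda>i. (m - R i) * (N i - R i)",
      OF assms(2) this]
  obtain C where C: "rank_covering \<iota> n \<rho> C" "card C \<le> q ^ (\<Sum>i<l. (m - R i) * (N i - R i))"
    unfolding assms(13,14) by blast
  \<comment> \<open>What remains is arithmetic of the exponent. The truncated subtractions are exact
    because \<open>R i \<le> m\<close> and \<open>R i \<le> N i\<close>.\<close>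
  have "(\<Sum>i<l. (m - R i) * (N i - R i)) = (\<Sum>i<l. m * (N i - R i) - R i * (N i - R i))"
    by (simp only: diff_mult_distrib)
  also have "\<dots> = (\<Sum>i<l. m * (N i - R i)) - (\<Sum>i<l. R i * (N i - R i))"
  proof (rule sum_subtractf_nat)
    fix i assume "i \<in> {..<l}"
    hence "R i \<le> m" using assms(12)[of i] by simp
    thus "R i * (N i - R i) \<le> m * (N i - R i)" by (rule mult_le_mono1)
  qed
  also have "(\<Sum>i<l. m * (N i - R i)) = m * (\<Sum>i<l. N i - R i)"
    by (rule sum_distrib_left[symmetric])
  also have "(\<Sum>i<l. N i - R i) = n - \<rho>"
    unfolding assms(13,14)[symmetric] using assms(11) by (intro sum_subtractf_nat) simp
  finally show ?thesis using K_R_le_card[OF C(1)] C(2) by simp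
qed

end
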